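(* Let $m\geqslant1$ be an integer and suppose that the bounded set $\Omega\subset\mathbb{R}^d$ satisfies an interior cone condition with radius $r>0$ and angle $\theta\in(0,\pi/2)$. Put $C_2=\frac{16(1+\sin\theta)^2m^2}{3\sin^2\theta}$ and $h_0=r/C_2$, and let $\phi:[0,\infty)\to\mathbb{R}$ be positive on $[0,1/2]$, supported in $[0,1]$, with nonnegative and continuous even extension to $\mathbb{R}$. Let $\hat x\in\Omega$ be fixed but arbitrary. Then there exists a constant $C_\lambda>0$, independent of the fill distance (the same constant works for all $X$ below), such that the following holds. Let $X=\{x_1,\ldots,x_N\}\subseteq\Omega$ have fill distance $h=h_{X,\Omega}\leqslant h_0$, let $\delta=2C_2h$ be the size of the supports of the weight functions $w_j(x)=\phi(\|x-x_j\|_2/\delta)$, and suppose that the set $\{x_j\in X:\ j\in J(\hat x)\}$, where $J(\hat x)=\{j:\|\hat x-x_j\|_2\leqslant\delta\}$, is $\mathbb{P}_m^d$-unisolvent. Then the MLS matrix $A(\hat x)$ formed with the shifted scaled basis functions satisfies $$\lambda_{\min}(A(\hat x))\geqslant C_\lambda>0.$$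
   Context: $\mathbb{P}_m^d$ is the space of $d$-variable polynomials of degree at most $m$, of dimension $Q=\binom{m+d}{d}$. A set of points is $\mathbb{P}_m^d$-unisolvent if the zero polynomial is the only polynomial in $\mathbb{P}_m^d$ vanishing on it. The fill distance is $h_{X,\Omega}=\sup_{x\in\Omega}\min_{1\leqslant j\leqslant N}\|x-x_j\|_2$. Interior cone condition with angle $\theta$ and radius $r$: for every $x\in\Omega$ there is a unit vector $\xi(x)$ such that $\{x+ty:\ y\in\mathbb{R}^d,\ \|y\|_2=1,\ y^T\xi(x)\geqslant\cos\theta,\ t\in[0,r]\}\subset\Omega$. The MLS matrix at $\hat x$ with the shifted scaled basis $\{(x-\hat x)^\beta/h^{|\beta|}\}_{0\leqslant|\beta|\leqslant m}$ is the symmetric $Q\times Q$ matrix $A(\hat x)$, indexed by multi-indices $\beta,\gamma$ with $|\beta|,|\gamma|\leqslant m$, with entries $$A_{\beta,\gamma}(\hat x)=\sum_{j=1}^N w_j(\hat x)\Big(\frac{x_j-\hat x}{h}\Big)^{\beta}\Big(\frac{x_j-\hat x}{h}\Big)^{\gamma}.$$ $\lambda_{\min}(A)=\min_{v\in\mathbb{R}^Q\setminus\{0\}}\frac{v^TAv}{v^Tv}$ denotes the smallest eigenvalue. *)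

theory Defs
  imports "HOL-Analysis.Analysis"
begin

text \<open>The space of \<open>d\<close>-vectors is \<open>real^'n\<close> with \<open>d = CARD('n)\<close>; multi-indices are functions
  \<open>'n \<Rightarrow> nat\<close>, and \<open>Q\<close> is the cardinality of \<open>multi_indices m\<close>.\<close>

definition multi_indices :: "nat \<Rightarrow> ('n::finite \<Rightarrow> nat) set" where
  "multi_indices m = {\<beta>. (\<Sum>i\<in>UNIV. \<beta> i) \<le> m}"

lemma finite_multi_indices: "finite (multi_indices m :: ('n::finite \<Rightarrow> nat) set)"
proof (rule finite_subset)
  show "multi_indices m \<subseteq> (\<Pi>\<^sub>E i\<in>(UNIV::'n set). {..m})"
  proof
    fix \<beta> :: "'n \<Rightarrow> nat" assume "\<beta> \<in> multi_indices m"
    then have "\<beta> i \<le> m" for i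
      using member_le_sum[of i UNIV \<beta>] by (simp add: multi_indices_def)
    then show "\<beta> \<in> (\<Pi>\<^sub>E i\<in>(UNIV::'n set). {..m})" by auto
  qed
qed (simp add: finite_PiE)

lemma multi_indices_nonempty: "multi_indices m \<noteq> {}"
  by (auto simp: multi_indices_def intro!: exI[of _ "\<lambda>_. 0"])

definition mpow :: "real^'n \<Rightarrow> ('n::finite \<Rightarrow> nat) \<Rightarrow> real" where
  "mpow z \<beta> = (\<Prod>i\<in>UNIV. (z $ i) ^ \<beta> i)"

text \<open>Real polynomials are identified with the functions they induce.\<close>

definition polys_le :: "nat \<Rightarrow> (real^'n::finite \<Rightarrow> real) set" where
  "polys_le m = {\<lambda>z. \<Sum>\<beta>\<in>multi_indices m. c \<beta> * mpow z \<beta> | c. True}"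

definition unisolvent :: "nat \<Rightarrow> (real^'n::finite) set \<Rightarrow> bool" where
  "unisolvent m X \<longleftrightarrow> (\<forall>p\<in>polys_le m. (\<forall>y\<in>X. p y = 0) \<longrightarrow> p = (\<lambda>_. 0))"

definition fill_distance :: "(real^'n::finite) set \<Rightarrow> (real^'n) set \<Rightarrow> real" where
  "fill_distance X \<Omega> = (SUP y\<in>\<Omega>. Min ((\<lambda>z. norm (y - z)) ` X))"

definition interior_cone_condition :: "(real^'n::finite) set \<Rightarrow> real \<Rightarrow> real \<Rightarrow> bool" where
  "interior_cone_condition \<Omega> \<theta> r \<longleftrightarrow>
     (\<forall>z\<in>\<Omega>. \<exists>\<xi>. norm \<xi> = 1 \<and>
        {z + t *\<^sub>R y | t y. norm y = 1 \<and> y \<bullet> \<xi> \<ge> cos \<theta> \<and> t \<in> {0..r}} \<subseteq> \<Omega>)"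

text \<open>The points are \<open>x 1, \<dots>, x N\<close>, and \<open>w j\<close> is the \<open>j\<close>-th weight function. Only entries with
  both indices in \<open>multi_indices m\<close> belong to the matrix of degree \<open>m\<close>.\<close>

definition mls_matrix ::
  "(nat \<Rightarrow> real^'n \<Rightarrow> real) \<Rightarrow> nat \<Rightarrow> (nat \<Rightarrow> real^'n) \<Rightarrow> real \<Rightarrow> real^'n
     \<Rightarrow> ('n::finite \<Rightarrow> nat) \<Rightarrow> ('n \<Rightarrow> nat) \<Rightarrow> real" where
  "mls_matrix w N x h xhat \<beta> \<gamma> =
     (\<Sum>j=1..N. w j xhat * mpow ((x j - xhat) /\<^sub>R h) \<beta> * mpow ((x j - xhat) /\<^sub>R h) \<gamma>)"

text \<open>For a matrix with rows and columns indexed by a finite set \<open>I\<close>, vectors are functions of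
  which only the values on \<open>I\<close> matter. The infimum below is a minimum, see
  \<open>lambda_min_is_minimum\<close>.\<close>

definition rayleigh :: "'i set \<Rightarrow> ('i \<Rightarrow> 'i \<Rightarrow> real) \<Rightarrow> ('i \<Rightarrow> real) \<Rightarrow> real" where
  "rayleigh I A v = (\<Sum>i\<in>I. \<Sum>k\<in>I. v i * A i k * v k) / (\<Sum>i\<in>I. v i * v i)"

definition lambda_min :: "'i set \<Rightarrow> ('i \<Rightarrow> 'i \<Rightarrow> real) \<Rightarrow> real" where
  "lambda_min I A = Inf {rayleigh I A v | v. \<exists>i\<in>I. v i \<noteq> 0}"

lemma lambda_min_is_minimum:
  assumes fin: "finite I" and ne: "I \<noteq> {}"
  shows "\<exists>v. (\<exists>i\<in>I. v i \<noteq> 0) \<and> rayleigh I A v = lambda_min I A"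
    and "\<And>v. \<exists>i\<in>I. v i \<noteq> 0 \<Longrightarrow> lambda_min I A \<le> rayleigh I A v"
proof -
  let ?q = "\<lambda>v. (\<Sum>i\<in>I. \<Sum>k\<in>I. v i * A i k * v k)"
  let ?n = "\<lambda>v::'a \<Rightarrow> real. (\<Sum>i\<in>I. v i * v i)"
  define B where "B = (\<Pi>\<^sub>E i\<in>UNIV. (if i \<in> I then {-1..1::real} else {0}))"
  define S where "S = B \<inter> {v. ?n v = 1}"
  have cont: "continuous_on UNIV (\<lambda>v::'a \<Rightarrow> real. v i)" for i
    by (rule continuous_on_product_coordinates)
  have "compactin (product_topology (\<lambda>i. euclidean) UNIV) B"
    unfolding B_def compactin_PiE by (simp add: compactin_euclidean_iff)
  then have "compact B"
    by (simp add: euclidean_product_topology compactin_euclidean_iff)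
  moreover have "closed {v. ?n v = 1}"
    by (intro closed_Collect_eq continuous_intros cont)
  ultimately have cS: "compact S" unfolding S_def by (rule compact_Int_closed)
  obtain i0 where i0: "i0 \<in> I" using ne by blast
  have "(\<lambda>i. if i = i0 then 1 else 0) \<in> S"
  proof -
    have "?n (\<lambda>i. if i = i0 then 1 else 0) = (\<Sum>i\<in>I. if i = i0 then 1 else 0)"
      by (rule sum.cong) auto
    then show ?thesis using i0 fin by (auto simp: S_def B_def)
  qed
  then have "S \<noteq> {}" by blast
  moreover have "continuous_on S ?q"
    by (intro continuous_intros continuous_on_subset[OF cont]) auto
  ultimately have "\<exists>u\<in>S. \<forall>v\<in>S. ?q u \<le> ?q v"
    by (rule continuous_attains_inf[OF cS])
  then obtain u where u: "u \<in> S" "\<And>v. v \<in> S \<Longrightarrow> ?q u \<le> ?q v"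
    by blast
  have nu: "?n u = 1" using u(1) by (simp add: S_def)
  have low: "rayleigh I A u \<le> rayleigh I A v" if v: "\<exists>i\<in>I. v i \<noteq> 0" for v
  proof -
    have pos: "?n v > 0"
    proof -
      obtain i where "i \<in> I" "v i \<noteq> 0" using v by blast
      then show ?thesis by (intro sum_pos2[OF fin, of i]) (auto simp: zero_less_mult_iff)
    qed
    define s where "s = sqrt (?n v)"
    have s: "s > 0" "s * s = ?n v" using pos by (auto simp: s_def)
    define v' where "v' = (\<lambda>i. if i \<in> I then v i / s else 0)"
    have n': "?n v' = 1"
    proof -
      have "?n v' = (\<Sum>i\<in>I. v i * v i / (s * s))" by (rule sum.cong) (auto simp: v'_def)
      also have "\<dots> = ?n v / (s * s)" by (simp add: sum_divide_distrib)
      finally show ?thesis using s pos by simp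
    qed
    have "\<bar>v' i\<bar> \<le> 1" if "i \<in> I" for i
    proof -
      have "v' i * v' i \<le> ?n v'" using that fin by (intro member_le_sum) auto
      then show ?thesis using n' abs_square_le_1[of "v' i"] by (simp add: power2_eq_square)
    qed
    then have "v' i \<in> (if i \<in> I then {-1..1} else {0})" for i
      by (cases "i \<in> I") (force simp: abs_le_iff, simp add: v'_def)
    then have "v' \<in> B" unfolding B_def PiE_UNIV_domain by blast
    then have "?q u \<le> ?q v'" using u(2) n' by (simp add: S_def)
    also have "?q v' = (\<Sum>i\<in>I. \<Sum>k\<in>I. v i * A i k * v k / (s * s))"
      by (intro sum.cong) (auto simp: v'_def)
    also have "\<dots> = ?q v / (s * s)" by (simp add: sum_divide_distrib)
    finally show ?thesis using nu s by (simp add: rayleigh_def)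
  qed
  have u0: "\<exists>i\<in>I. u i \<noteq> 0" 
  proof (rule ccontr)
    assume "\<not> ?thesis"
    then have "?n u = 0" by (intro sum.neutral) auto
    then show False using nu by simp
  qed
  have eq: "lambda_min I A = rayleigh I A u"
    unfolding lambda_min_def by (rule cInf_eq_minimum) (use u0 low in auto)
  show "\<exists>v. (\<exists>i\<in>I. v i \<noteq> 0) \<and> rayleigh I A v = lambda_min I A" using u0 eq by auto
  show "\<And>v. \<exists>i\<in>I. v i \<noteq> 0 \<Longrightarrow> lambda_min I A \<le> rayleigh I A v" using low eq by auto
qed

end

theory Submission
  imports Defs "HOL-Computational_Algebra.Polynomial"
begin

text \<open>In the coordinates \<open>z = (x - xhat) / h\<close> the cone at \<open>xhat\<close> contains a ball of radius
  \<open>\<rho> \<ge> 32 m\<^sup>2 / 3\<close>, and every unit ball centred in the cone contains a scaled data point. Near a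
  point where \<open>\<bar>p\<bar>\<close> attains its maximum over the large ball, comparison with the Chebyshev polynomial
  along chords shows that \<open>\<bar>p\<bar>\<close> is at least \<open>7/16\<close> of this maximum on a whole unit ball, hence at a
  data point, whose weight is bounded below because it lies within \<open>\<delta> / 2\<close> of \<open>xhat\<close>. The
  maximum of \<open>\<bar>p\<bar>\<close> over the large ball dominates the Euclidean norm of the coefficients.\<close>

section \<open>Multiple-angle estimates and Chebyshev polynomials\<close>

lemma abs_sin_of_nat_mult_le: "\<bar>sin (real n * x)\<bar> \<le> real n * \<bar>sin x\<bar>"
proof (induction n)
  case (Suc n)
  have "sin (real (Suc n) * x) = sin (real n * x) * cos x + cos (real n * x) * sin x"
    by (simp add: algebra_simps sin_add)
  then have "\<bar>sin (real (Suc n) * x)\<bar> \<le> \<bar>sin (real n * x)\<bar> * \<bar>cos x\<bar> + \<bar>cos (real n * x)\<bar> * \<bar>sin x\<bar>"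
    by (metis abs_mult abs_triangle_ineq)
  also have "\<dots> \<le> \<bar>sin (real n * x)\<bar> * 1 + 1 * \<bar>sin x\<bar>"
    by (intro add_mono mult_mono) auto
  finally show ?case using Suc.IH by (simp add: algebra_simps)
qed simp

text \<open>Half-angle formulas reduce this to the preceding sine bound. With
  \<open>t = cos x\<close> it says that the Chebyshev polynomial lies above its tangent line at
  \<open>1\<close>, where its slope is the square of \<open>n\<close>.\<close>

lemma cos_of_nat_mult_ge: "1 - (real n)\<^sup>2 * (1 - cos x) \<le> cos (real n * x)"
proof -
  have c: "1 - cos y = 2 * (sin (y / 2))\<^sup>2" for y :: real
    using cos_double_sin[of "y / 2"] by simp
  have "\<bar>sin (real n * (x / 2))\<bar>\<^sup>2 \<le> (real n * \<bar>sin (x / 2)\<bar>)\<^sup>2"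
    by (intro power_mono abs_sin_of_nat_mult_le) simp
  then have "(sin (real n * x / 2))\<^sup>2 \<le> (real n)\<^sup>2 * (sin (x / 2))\<^sup>2"
    by (simp add: power_mult_distrib)
  then have "1 - cos (real n * x) \<le> (real n)\<^sup>2 * (1 - cos x)"
    unfolding c[of x] c[of "real n * x"] by simp
  then show ?thesis by simp
qed

text \<open>Three-term recurrence: the next polynomial is \<open>2 * x * T - S\<close>. Only a
  degree bound and the values at cosines are recorded.\<close>

lemma chebyshev_poly_exists:
  "\<exists>T :: real poly. degree T \<le> n \<and> (\<forall>x. poly T (cos x) = cos (real n * x))"
proof (induction n rule: induct_nat_012)
  case 0
  show ?case by (rule exI[of _ 1]) simp
next
  case 1
  show ?case by (rule exI[of _ "[:0, 1:]"]) simp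
next
  case (ge2 n)
  then obtain S T :: "real poly" where S: "degree S \<le> n" "\<And>x. poly S (cos x) = cos (real n * x)"
    and T: "degree T \<le> Suc n" "\<And>x. poly T (cos x) = cos (real (Suc n) * x)"
    by blast
  have "degree ([:0, 2:] * T - S) \<le> Suc (Suc n)"
    using S(1) T(1) degree_mult_le[of "[:0, 2:]" T] by (intro degree_diff_le) auto
  moreover have "poly ([:0, 2:] * T - S) (cos x) = cos (real (Suc (Suc n)) * x)" for x
  proof -
    have "cos (real (Suc n) * x + x) + cos (real (Suc n) * x - x) = 2 * cos x * cos (real (Suc n) * x)"
      by (simp add: cos_add cos_diff)
    moreover have "real (Suc n) * x - x = real n * x" "real (Suc n) * x + x = real (Suc (Suc n)) * x"
      by (simp_all add: algebra_simps)
    ultimately show ?thesis by (simp add: S T)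
  qed
  ultimately show ?case by blast
qed

section \<open>Divided differences and the extremality of Chebyshev polynomials\<close>

text \<open>The sum is the coefficient of the Lagrange interpolant of \<open>p\<close> on
  \<open>X\<close> at exponent \<open>card X - 1\<close>. The interpolant equals \<open>p\<close>,
  whose degree is smaller than that.\<close>

lemma divided_difference_eq_0:
  fixes p :: "'a::field poly"
  assumes "finite X" "degree p + 1 < card X"
  shows "(\<Sum>x\<in>X. poly p x / (\<Prod>y\<in>X - {x}. x - y)) = 0"
proof -
  define B where "B x = (\<Prod>y\<in>X - {x}. [:- y, 1:])" for x
  define D where "D x = (\<Prod>y\<in>X - {x}. x - y)" for x
  define L where "L = (\<Sum>x\<in>X. smult (poly p x / D x) (B x))"
  have polyB: "poly (B x) z = (\<Prod>y\<in>X - {x}. z - y)" for x z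
    by (simp add: B_def poly_prod)
  have D0: "D x \<noteq> 0" for x
    unfolding D_def using assms(1) by (subst prod_zero_iff) auto
  have degB: "degree (B x) = card X - 1" if "x \<in> X" for x
    unfolding B_def using that assms(1) by (subst degree_prod_eq_sum_degree) auto
  have lead: "coeff (B x) (card X - 1) = 1" if "x \<in> X" for x
    using degB[OF that] lead_coeff_prod[of "\<lambda>y. [:- y, 1:]" "X - {x}"] by (simp add: B_def)
  have "degree L \<le> card X - 1"
    unfolding L_def using degB by (intro degree_sum_le assms(1)) (auto intro: order.trans[OF degree_smult_le])
  moreover have "poly L z = poly p z" if "z \<in> X" for z
  proof -
    have "poly L z = (\<Sum>x\<in>X. if x = z then poly p z else 0)"
      unfolding L_def poly_sum
    proof (intro sum.cong refl)
      fix x assume "x \<in> X"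
      have "x \<noteq> z \<Longrightarrow> poly (B x) z = 0"
        unfolding polyB using that assms(1) by (intro prod_zero) auto
      then show "poly (smult (poly p x / D x) (B x)) z = (if x = z then poly p z else 0)"
        using D0[of z] by (auto simp: polyB D_def)
    qed
    then show ?thesis using that assms(1) by simp
  qed
  ultimately have "L = p"
    using assms by (intro poly_eqI_degree[of X]) auto
  then have "coeff L (card X - 1) = 0"
    using assms(2) by (simp add: coeff_eq_0)
  also have "coeff L (card X - 1) = (\<Sum>x\<in>X. poly p x / D x)"
    unfolding L_def coeff_sum by (intro sum.cong) (auto simp: lead[simplified])
  finally show ?thesis by (simp add: D_def)
qed

text \<open>For decreasing nodes the negative factors are exactly the \<open>i\<close> factors with
  \<open>j < i\<close>.\<close>

lemma sign_prod_differences: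
  fixes x :: "nat \<Rightarrow> real"
  assumes dec: "\<And>i j. i < j \<Longrightarrow> j \<le> n \<Longrightarrow> x j < x i" and "i \<le> n"
  shows "0 < (-1) ^ i * (\<Prod>j\<in>{..n} - {i}. x i - x j)"
proof -
  have "{..n} - {i} = {..<i} \<union> {i<..n}" using \<open>i \<le> n\<close> by auto
  moreover have "(\<Prod>j\<in>{..<i} \<union> {i<..n}. x i - x j) = (\<Prod>j<i. x i - x j) * (\<Prod>j\<in>{i<..n}. x i - x j)"
    by (rule prod.union_disjoint) auto
  moreover have "(\<Prod>j<i. x i - x j) = (\<Prod>j<i. -1 * (x j - x i))" by simp
  moreover have "\<dots> = (-1) ^ i * (\<Prod>j<i. x j - x i)"
    by (simp only: prod.distrib prod_constant card_lessThan)
  ultimately have "(-1) ^ i * (\<Prod>j\<in>{..n} - {i}. x i - x j)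
      = (\<Prod>j<i. x j - x i) * (\<Prod>j\<in>{i<..n}. x i - x j)"
    by (simp only: mult.assoc left_minus_one_mult_self)
  moreover have "0 < (\<Prod>j<i. x j - x i)"
    using assms by (intro prod_pos) auto
  moreover have "0 < (\<Prod>j\<in>{i<..n}. x i - x j)"
    using dec by (intro prod_pos) auto
  ultimately show ?thesis by (simp only: mult_pos_pos)
qed

text \<open>The divided difference of \<open>g\<close> over these \<open>n + 2\<close> nodes
  vanishes, and its weights \<open>1 / P i\<close> alternate in sign. The term at \<open>x 0\<close>
  is zero and those from \<open>x 2\<close> on are nonpositive, so the term at \<open>x 1\<close> is
  nonnegative, while its weight is negative.\<close>

lemma poly_sign_at_decreasing_nodes:
  fixes g :: "real poly"
  assumes dec: "\<And>i j. i < j \<Longrightarrow> j \<le> Suc n \<Longrightarrow> x j < x i"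
    and deg: "degree g \<le> n" and "poly g (x 0) = 0"
    and alt: "\<And>i. 2 \<le> i \<Longrightarrow> i \<le> Suc n \<Longrightarrow> (-1) ^ i * poly g (x i) \<le> 0"
  shows "poly g (x 1) \<le> 0"
proof -
  define P where "P i = (\<Prod>j\<in>{..Suc n} - {i}. x i - x j)" for i
  have P: "0 < (-1) ^ i * P i" if "i \<le> Suc n" for i
    unfolding P_def using sign_prod_differences[of "Suc n" x i] dec that by blast
  have inj: "inj_on x {..Suc n}"
    using dec by (intro linorder_inj_onI) force+
  have "(\<Sum>i\<le>Suc n. poly g (x i) / P i) = (\<Sum>z\<in>x ` {..Suc n}. poly g z / (\<Prod>y\<in>x ` {..Suc n} - {z}. z - y))"
  proof (subst sum.reindex[OF inj], unfold o_def, intro sum.cong refl)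
    fix i assume "i \<in> {..Suc n}"
    then have "x ` {..Suc n} - {x i} = x ` ({..Suc n} - {i})"
      using inj by (auto simp: inj_on_def)
    moreover have "inj_on x ({..Suc n} - {i})" using inj by (rule inj_on_subset) auto
    ultimately show "poly g (x i) / P i = poly g (x i) / (\<Prod>y\<in>x ` {..Suc n} - {x i}. x i - y)"
      by (simp add: P_def prod.reindex)
  qed
  also have "\<dots> = 0"
    using deg inj by (intro divided_difference_eq_0) (auto simp: card_image)
  finally have "(\<Sum>i\<le>Suc n. poly g (x i) / P i) = 0" .
  moreover have "{..Suc n} = insert 0 (insert 1 {2..Suc n})" by auto
  ultimately have "poly g (x 1) / P 1 + (\<Sum>i\<in>{2..Suc n}. poly g (x i) / P i) = 0"
    using \<open>poly g (x 0) = 0\<close> by simp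
  moreover have "(\<Sum>i\<in>{2..Suc n}. poly g (x i) / P i) \<le> 0"
  proof (rule sum_nonpos)
    fix i assume i: "i \<in> {2..Suc n}"
    have "poly g (x i) / P i = ((-1) ^ i * poly g (x i)) / ((-1) ^ i * P i)" by simp
    also have "\<dots> \<le> 0" using P[of i] alt[of i] i by (intro divide_nonpos_pos) auto
    finally show "poly g (x i) / P i \<le> 0" .
  qed
  ultimately have "0 \<le> poly g (x 1) / P 1" by linarith
  moreover have "P 1 < 0" using P[of 1] by simp
  ultimately show ?thesis by (simp add: zero_le_divide_iff)
qed

text \<open>The difference between \<open>M\<close> times the Chebyshev polynomial and \<open>q\<close> vanishes at \<open>1\<close> and has
  alternating signs at the Chebyshev extrema \<open>cos (k * pi / n)\<close>. The divided difference over these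
  points and \<open>t\<close> is \<open>0\<close>, which fixes the sign at \<open>t\<close>.\<close>

lemma poly_ge_near_endpoint_maximum:
  fixes q :: "real poly"
  assumes "0 < n" "degree q \<le> n"
    and bound: "\<And>t. \<bar>t\<bar> \<le> 1 \<Longrightarrow> \<bar>poly q t\<bar> \<le> M" and "poly q 1 = M" and "\<bar>t\<bar> \<le> 1"
  shows "M * (1 - (real n)\<^sup>2 * (1 - t)) \<le> poly q t"
proof -
  have M: "0 \<le> M" using bound[of 1] by linarith
  \<comment> \<open>In the second case the claimed lower bound is at most \<open>- M\<close>, so the
    bound on \<open>q\<close> suffices. Only the third case, close to the endpoint, needs the
    Chebyshev comparison.\<close>
  consider "t = 1" | "t \<le> 1 - 2 / (real n)\<^sup>2" | "t < 1" "1 - 2 / (real n)\<^sup>2 < t"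
    using assms(5) by linarith
  then show ?thesis
  proof cases
    case 1
    then show ?thesis using assms(4) by simp
  next
    case 2
    have "1 - (real n)\<^sup>2 * (1 - t) \<le> -1"
      using 2 \<open>0 < n\<close> by (simp add: field_simps)
    then have "M * (1 - (real n)\<^sup>2 * (1 - t)) \<le> M * -1" using M by (rule mult_left_mono)
    then show ?thesis using bound[of t] assms(5) by auto
  next
    case 3
    obtain T :: "real poly" where T: "degree T \<le> n" "\<And>x. poly T (cos x) = cos (real n * x)"
      using chebyshev_poly_exists by blast
    \<comment> \<open>Evaluating the cosine bound at \<open>pi / n\<close>, where the multiple angle
      has cosine \<open>-1\<close>, shows that \<open>t\<close> lies between the two largest extrema
      \<open>1\<close> and \<open>cos (pi / n)\<close>.\<close>
    have "cos (pi / n) \<le> 1 - 2 / (real n)\<^sup>2"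
      using cos_of_nat_mult_ge[of n "pi / n"] \<open>0 < n\<close> by (simp add: field_simps)
    then have t: "cos (pi / n) < t" using 3 by simp
    \<comment> \<open>The extrema with \<open>t\<close> inserted after the first one: from index
      \<open>2\<close> on, \<open>x i\<close> is the extremum number \<open>i - 1\<close>, giving
      \<open>n + 2\<close> decreasing nodes.\<close>
    define x where "x i = (if i = 0 then 1 else if i = 1 then t else cos (real (i - 1) * (pi / n)))" for i
    have ang: "real k * (pi / n) \<le> pi" if "k \<le> n" for k
      using that \<open>0 < n\<close> by (simp add: field_simps)
    have cos_dec: "cos (real k * (pi / n)) < cos (real j * (pi / n))" if "j < k" "k \<le> n" for j k
      using that ang[of k] \<open>0 < n\<close> by (intro cos_monotone_0_pi) (auto intro!: divide_strict_right_mono)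
    have dec: "x j < x i" if ij: "i < j" "j \<le> Suc n" for i j
    proof -
      have xt: "x k < t" if "2 \<le> k" "k \<le> Suc n" for k
      proof (cases "k = 2")
        case True
        then show ?thesis using t by (simp add: x_def)
      next
        case False
        then have "cos (real (k - 1) * (pi / n)) < cos (real 1 * (pi / n))"
          using that by (intro cos_dec) auto
        then show ?thesis using that t by (simp add: x_def)
      qed
      consider "i = 0" "j = 1" | "i \<le> 1" "2 \<le> j" | "2 \<le> i" using ij by linarith
      then show ?thesis
      proof cases
        case 1 then show ?thesis using 3 by (simp add: x_def)
      next
        case 2 then show ?thesis using xt[of j] ij 3 by (auto simp: x_def)
      next
        case 3 then show ?thesis using cos_dec[of "i - 1" "j - 1"] ij by (simp add: x_def)
      qed
    qed
    let ?g = "smult M T - q"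
    have "poly ?g (x 1) \<le> 0"
    proof (rule poly_sign_at_decreasing_nodes[OF dec])
      show "degree ?g \<le> n"
        using T(1) assms(2) by (intro degree_diff_le) (auto intro: order.trans[OF degree_smult_le])
      show "poly ?g (x 0) = 0" using T(2)[of 0] assms(4) by (simp add: x_def)
      fix i assume i: "2 \<le> i" "i \<le> Suc n"
      then obtain k where k: "i = Suc k" by (cases i) auto
      have "poly T (x i) = (-1) ^ k"
        using i \<open>0 < n\<close> T(2)[of "real k * (pi / n)"] by (simp add: x_def k cos_npi)
      moreover have "\<bar>(-1) ^ i * poly q (x i)\<bar> \<le> M"
        using bound[of "x i"] i by (simp add: x_def abs_mult power_abs abs_cos_le_one)
      \<comment> \<open>Since \<open>i = Suc k\<close>, the Chebyshev term contributes exactly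
        \<open>- M\<close>, and the term from \<open>q\<close> is at most \<open>M\<close>.\<close>
      ultimately show "(-1) ^ i * poly ?g (x i) \<le> 0"
        by (cases "even k") (auto simp: k)
    qed
    then have "M * poly T t \<le> poly q t" by (simp add: x_def)
    moreover have "1 - (real n)\<^sup>2 * (1 - t) \<le> poly T t"
      using cos_of_nat_mult_ge[of n "arccos t"] T(2)[of "arccos t"] assms(5) by (simp add: abs_le_iff)
    ultimately show ?thesis using M by (meson mult_left_mono order.trans)
  qed
qed

section \<open>Polynomials on lines and on chords of a ball\<close>

lemma mpow_restrict_line:
  assumes "(\<Sum>i\<in>UNIV. \<beta> i) \<le> m"
  shows "\<exists>q. degree q \<le> m \<and> (\<forall>t. poly q t = mpow (a + t *\<^sub>R b) \<beta>)"
proof (intro exI conjI allI)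
  let ?f = "\<lambda>i. [:a $ i, b $ i:] ^ \<beta> i"
  have "degree (\<Prod>i\<in>UNIV. ?f i) \<le> (\<Sum>i\<in>UNIV. degree (?f i))"
    using degree_prod_sum_le[of UNIV ?f] by simp
  also have "\<dots> \<le> (\<Sum>i\<in>UNIV. \<beta> i)"
    by (intro sum_mono order.trans[OF degree_power_le]) auto
  finally show "degree (\<Prod>i\<in>UNIV. ?f i) \<le> m" using assms by simp
  show "poly (\<Prod>i\<in>UNIV. ?f i) t = mpow (a + t *\<^sub>R b) \<beta>" for t
    by (simp add: poly_prod mpow_def)
qed

lemma polys_le_restrict_line:
  assumes "p \<in> polys_le m"
  obtains q where "degree q \<le> m" "\<And>t. poly q t = p (a + t *\<^sub>R b)"
proof -
  obtain c where p: "p = (\<lambda>z. \<Sum>\<beta>\<in>multi_indices m. c \<beta> * mpow z \<beta>)"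
    using assms by (auto simp: polys_le_def)
  have "\<forall>\<beta>\<in>multi_indices m. \<exists>q. degree q \<le> m \<and> (\<forall>t. poly q t = mpow (a + t *\<^sub>R b) \<beta>)"
    by (auto simp: multi_indices_def intro!: mpow_restrict_line)
  then obtain q where q: "\<And>\<beta>. \<beta> \<in> multi_indices m \<Longrightarrow> degree (q \<beta>) \<le> m"
      "\<And>\<beta> t. \<beta> \<in> multi_indices m \<Longrightarrow> poly (q \<beta>) t = mpow (a + t *\<^sub>R b) \<beta>"
    by metis
  show ?thesis
  proof
    show "degree (\<Sum>\<beta>\<in>multi_indices m. smult (c \<beta>) (q \<beta>)) \<le> m"
      using q(1) by (intro degree_sum_le finite_multi_indices) (auto intro: order.trans[OF degree_smult_le])
    show "poly (\<Sum>\<beta>\<in>multi_indices m. smult (c \<beta>) (q \<beta>)) t = p (a + t *\<^sub>R b)" for t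
      by (simp add: poly_sum p q(2))
  qed
qed

lemma continuous_on_polys_le:
  assumes "p \<in> polys_le m"
  shows "continuous_on S p"
  using assms by (auto simp: polys_le_def mpow_def intro!: continuous_intros)

text \<open>The segment from \<open>x\<close> to \<open>x + T *\<^sub>R w\<close> is mapped affinely
  to \<open>[-1, 1]\<close> with \<open>x\<close> at \<open>1\<close>. Then \<open>x + w\<close>
  sits at \<open>1 - 2 / T\<close>, where the one-variable bound gives the stated factor.\<close>

lemma polys_le_abs_ge_near_maximum:
  assumes "0 < m" and p: "p \<in> polys_le m" and "1 \<le> T"
    and max: "\<And>t. 0 \<le> t \<Longrightarrow> t \<le> T \<Longrightarrow> \<bar>p (x + t *\<^sub>R w)\<bar> \<le> \<bar>p x\<bar>"
  shows "\<bar>p x\<bar> * (1 - 2 * (real m)\<^sup>2 / T) \<le> \<bar>p (x + w)\<bar>"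
proof -
  obtain q where q: "degree q \<le> m"
    "\<And>t. poly q t = p ((x + (T / 2) *\<^sub>R w) + t *\<^sub>R ((- T / 2) *\<^sub>R w))"
    using polys_le_restrict_line[OF p, of "x + (T / 2) *\<^sub>R w" "(- T / 2) *\<^sub>R w"] by blast
  have qe: "poly q t = p (x + (T / 2 * (1 - t)) *\<^sub>R w)" for t
    unfolding q(2) by (simp add: algebra_simps diff_divide_distrib)
  \<comment> \<open>Multiplying by the sign of \<open>p x\<close> makes the endpoint value equal to
    the maximum of the absolute value.\<close>
  define s where "s = (if p x \<ge> 0 then 1 else - 1 :: real)"
  have s: "s * p x = \<bar>p x\<bar>" "\<bar>s\<bar> = 1" by (auto simp: s_def)
  have "\<bar>p x\<bar> * (1 - (real m)\<^sup>2 * (1 - (1 - 2 / T))) \<le> poly (smult s q) (1 - 2 / T)"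
  proof (rule poly_ge_near_endpoint_maximum[OF \<open>0 < m\<close>])
    show "degree (smult s q) \<le> m" using q(1) by (auto intro: order.trans[OF degree_smult_le])
    show "poly (smult s q) 1 = \<bar>p x\<bar>" by (simp add: qe s)
    show "\<bar>1 - 2 / T\<bar> \<le> 1" using \<open>1 \<le> T\<close> by (simp add: abs_le_iff field_simps)
    show "\<bar>poly (smult s q) t\<bar> \<le> \<bar>p x\<bar>" if "\<bar>t\<bar> \<le> 1" for t
    proof -
      have "T / 2 * (1 - t) \<le> T / 2 * 2" using that \<open>1 \<le> T\<close> by (intro mult_left_mono) auto
      then show ?thesis using max[of "T / 2 * (1 - t)"] that \<open>1 \<le> T\<close> by (simp add: qe abs_mult s)
    qed
  qed
  also have "poly (smult s q) (1 - 2 / T) = s * p (x + w)" using \<open>1 \<le> T\<close> by (simp add: qe)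
  also have "\<dots> \<le> \<bar>p (x + w)\<bar>" using s(2) abs_ge_self[of "s * p (x + w)"] by (simp add: abs_mult)
  finally show ?thesis by (simp add: mult.commute)
qed

text \<open>The origin stands for a point of a ball of radius \<open>\<rho>\<close> with centre
  \<open>D *\<^sub>R u\<close>. A ray from it through any point of the unit ball around
  \<open>2 *\<^sub>R u\<close> stays in the large ball up to parameter \<open>\<rho> / 3\<close>,
  wherever in the ball the origin lies.\<close>

lemma chord_in_ball:
  fixes u e :: "'a::real_inner"
  assumes "norm u = 1" "norm e \<le> 1" "0 \<le> D" "D \<le> \<rho>" "0 \<le> t" "t \<le> \<rho> / 3"
  shows "norm (t *\<^sub>R (2 *\<^sub>R u + e) - D *\<^sub>R u) \<le> \<rho>"
proof -
  define w where "w = 2 *\<^sub>R u + e"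
  have w3: "norm w \<le> 3"
    unfolding w_def using norm_triangle_ineq[of "2 *\<^sub>R u" e] assms by simp
  have uu: "u \<bullet> u = 1" using assms(1) by (simp add: norm_eq_1)
  have ee: "e \<bullet> e \<le> 1" using assms(2) by (simp add: norm_le_square)
  have ww: "w \<bullet> w \<le> 9" using w3 by (simp add: norm_le_square)
  have "w \<bullet> w = 4 + 4 * (u \<bullet> e) + e \<bullet> e" "w \<bullet> u = 2 + u \<bullet> e"
    by (simp_all add: w_def inner_simps uu inner_commute)
  then have wu: "w \<bullet> w + 3 \<le> 4 * (w \<bullet> u)" using ee by simp
  then have wu3: "w \<bullet> w \<le> 3 * (w \<bullet> u)" using ww by simp
  have D\<rho>: "D * D \<le> \<rho> * D" using assms by (intro mult_right_mono)
  have "norm (t *\<^sub>R w - D *\<^sub>R u)^2 = t * t * (w \<bullet> w) - 2 * t * D * (w \<bullet> u) + D * D"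
    unfolding power2_norm_eq_inner by (simp add: inner_simps uu inner_commute algebra_simps)
  also have "\<dots> \<le> \<rho>\<^sup>2"
  proof -
    have wn: "0 \<le> w \<bullet> w" "0 \<le> w \<bullet> u" using wu3 inner_ge_zero[of w] by linarith+
    \<comment> \<open>One factor \<open>t\<close> is replaced by \<open>\<rho> / 3\<close>, and
      \<open>\<rho>\<close> is split as \<open>D + (\<rho> - D)\<close>. The part with
      \<open>D\<close> is absorbed by the mixed inner product, and the rest costs at most
      \<open>\<rho> * (\<rho> - D)\<close>.\<close>
    have a: "t * (t * (w \<bullet> w)) \<le> t * (\<rho> / 3 * (w \<bullet> w))"
      using assms wn by (intro mult_left_mono mult_right_mono) auto
    have b: "(t * D) * (w \<bullet> w) \<le> (t * D) * (3 * (w \<bullet> u))"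
      using assms wu3 by (intro mult_left_mono) auto
    have c: "(t * (\<rho> - D)) * (w \<bullet> w) \<le> (\<rho> / 3 * (\<rho> - D)) * 9"
      using assms wn ww by (intro mult_mono) auto
    have d: "0 \<le> t * D * (w \<bullet> w)" using assms wn by simp
    show ?thesis using a b c d D\<rho> by (simp add: power2_eq_square algebra_simps)
  qed
  finally show ?thesis using assms by (simp add: w_def power2_le_iff_abs_le)
qed

text \<open>The ball of radius \<open>1\<close> is placed at depth \<open>2\<close> below a maximum point of \<open>\<bar>p\<bar>\<close>, so that the
  chords from that point through the small ball are long.\<close>

lemma polys_le_large_on_unit_ball:
  fixes c :: "real^'n"
  assumes "0 < m" and p: "p \<in> polys_le m" and "3 \<le> \<rho>"
  obtains y where "cball y 1 \<subseteq> cball c \<rho>"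
    "\<And>z z'. z \<in> cball y 1 \<Longrightarrow> z' \<in> cball c \<rho> \<Longrightarrow> \<bar>p z'\<bar> * (1 - 6 * (real m)\<^sup>2 / \<rho>) \<le> \<bar>p z\<bar>"
proof (cases "1 - 6 * (real m)\<^sup>2 / \<rho> \<ge> 0")
  case False
  \<comment> \<open>A negative factor makes the estimate trivial, so any unit ball inside the large
    one will do.\<close>
  have "\<bar>p z'\<bar> * (1 - 6 * (real m)\<^sup>2 / \<rho>) \<le> \<bar>p z\<bar>" for z z'
    using False by (intro order.trans[OF mult_nonneg_nonpos abs_ge_zero]) auto
  then show ?thesis using \<open>3 \<le> \<rho>\<close> by (intro that[of c]) auto
next
  case True
  have "continuous_on (cball c \<rho>) (\<lambda>z. \<bar>p z\<bar>)"
    by (intro continuous_intros continuous_on_polys_le[OF p])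
  moreover have "cball c \<rho> \<noteq> {}" using \<open>3 \<le> \<rho>\<close> by simp
  ultimately obtain x where x: "x \<in> cball c \<rho>" "\<And>z. z \<in> cball c \<rho> \<Longrightarrow> \<bar>p z\<bar> \<le> \<bar>p x\<bar>"
    using continuous_attains_sup[OF compact_cball] by blast
  define D where "D = norm (c - x)"
  have D: "0 \<le> D" "D \<le> \<rho>" using x(1) by (auto simp: D_def dist_norm)
  \<comment> \<open>\<open>u\<close> points from the maximum point to the centre; if the two
    coincide, every unit vector works.\<close>
  obtain u where u: "norm u = 1" "c - x = D *\<^sub>R u"
  proof (cases "D = 0")
    case True
    obtain b :: "real^'n" where "b \<in> Basis" using nonempty_Basis by blast
    then show ?thesis using that[of b] True by (simp add: D_def)
  next
    case False
    then show ?thesis using that[of "(c - x) /\<^sub>R D"] by (simp add: D_def)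
  qed
  have chord: "x + t *\<^sub>R (2 *\<^sub>R u + e) \<in> cball c \<rho>" if "norm e \<le> 1" "0 \<le> t" "t \<le> \<rho> / 3" for t e
  proof -
    have "x + t *\<^sub>R (2 *\<^sub>R u + e) - c = t *\<^sub>R (2 *\<^sub>R u + e) - D *\<^sub>R u" using u(2) by (simp add: algebra_simps)
    then show ?thesis
      using chord_in_ball[OF u(1) that(1) D that(2,3)] by (simp only: mem_cball dist_norm norm_minus_commute[of c])
  qed
  have split: "\<exists>e. norm e \<le> 1 \<and> z = x + (2 *\<^sub>R u + e)" if "z \<in> cball (x + 2 *\<^sub>R u) 1" for z
    using that by (intro exI[of _ "z - (x + 2 *\<^sub>R u)"]) (simp add: dist_norm norm_minus_commute)
  show ?thesis
  proof
    show "cball (x + 2 *\<^sub>R u) 1 \<subseteq> cball c \<rho>"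
      using split chord[of _ 1] \<open>3 \<le> \<rho>\<close> by fastforce
    fix z z' assume z: "z \<in> cball (x + 2 *\<^sub>R u) 1" "z' \<in> cball c \<rho>"
    obtain e where e: "norm e \<le> 1" "z = x + (2 *\<^sub>R u + e)" using split[OF z(1)] by blast
    have "\<bar>p z'\<bar> * (1 - 6 * (real m)\<^sup>2 / \<rho>) \<le> \<bar>p x\<bar> * (1 - 6 * (real m)\<^sup>2 / \<rho>)"
      using x(2)[OF z(2)] True by (rule mult_right_mono)
    also have "\<dots> = \<bar>p x\<bar> * (1 - 2 * (real m)\<^sup>2 / (\<rho> / 3))" by simp
    also have "\<dots> \<le> \<bar>p (x + (2 *\<^sub>R u + e))\<bar>"
      using x(2)[OF chord[OF e(1)]] \<open>3 \<le> \<rho>\<close> by (intro polys_le_abs_ge_near_maximum[OF \<open>0 < m\<close> p]) auto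
    finally show "\<bar>p z'\<bar> * (1 - 6 * (real m)\<^sup>2 / \<rho>) \<le> \<bar>p z\<bar>" by (simp add: e(2))
  qed
qed

section \<open>Grids, Gram matrices and the size of coefficients\<close>

text \<open>Induction on the coordinates. With the others fixed, the sum is a polynomial in
  coordinate \<open>a\<close> with more roots than its degree, so each of its coefficients vanishes.
  Such a coefficient is a sum of the same kind over the exponents with prescribed value at
  \<open>a\<close>, and these are still separated by the remaining coordinates.\<close>

lemma grid_unisolvent:
  fixes v :: "('i \<Rightarrow> nat) \<Rightarrow> 'a::idom"
  assumes "finite A" "finite I"
    and "\<And>\<beta> \<gamma>. \<beta> \<in> I \<Longrightarrow> \<gamma> \<in> I \<Longrightarrow> (\<And>i. i \<in> A \<Longrightarrow> \<beta> i = \<gamma> i) \<Longrightarrow> \<beta> = \<gamma>"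
    and "\<And>\<beta> i. \<beta> \<in> I \<Longrightarrow> i \<in> A \<Longrightarrow> \<beta> i < card (G i)"
    and "\<And>z. (\<And>i. i \<in> A \<Longrightarrow> z i \<in> G i) \<Longrightarrow> (\<Sum>\<beta>\<in>I. v \<beta> * (\<Prod>i\<in>A. z i ^ \<beta> i)) = 0"
    and "\<beta> \<in> I"
  shows "v \<beta> = 0"
  using assms
proof (induction A arbitrary: I \<beta> rule: finite_induct)
  case empty
  then have "I = {\<beta>}" by blast
  then show ?case using empty.prems(4) by simp
next
  case (insert a A)
  define K where "K k = {\<gamma> \<in> I. \<gamma> a = k}" for k
  have zero: "(\<Sum>\<gamma>\<in>K k. v \<gamma> * (\<Prod>i\<in>A. z i ^ \<gamma> i)) = 0"
    if z: "\<And>i. i \<in> A \<Longrightarrow> z i \<in> G i" and k: "k = \<beta> a" for z k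
  proof -
    define q where "q = (\<Sum>\<gamma>\<in>I. monom (v \<gamma> * (\<Prod>i\<in>A. z i ^ \<gamma> i)) (\<gamma> a))"
    have pos: "0 < card (G a)" using insert.prems(3)[OF insert.prems(5), of a] by simp
    have "degree q \<le> card (G a) - 1"
      unfolding q_def using insert.prems(3)[of _ a]
      by (intro degree_sum_le insert.prems(1) order.trans[OF degree_monom_le]) fastforce
    moreover have "poly q t = 0" if t: "t \<in> G a" for t
    proof -
      let ?z = "z(a := t)"
      have "(\<Prod>i\<in>insert a A. ?z i ^ \<gamma> i) = t ^ \<gamma> a * (\<Prod>i\<in>A. z i ^ \<gamma> i)" for \<gamma> :: "'i \<Rightarrow> nat"
        using insert.hyps by (simp, intro disjI2 prod.cong) auto
      then have "poly q t = (\<Sum>\<gamma>\<in>I. v \<gamma> * (\<Prod>i\<in>insert a A. ?z i ^ \<gamma> i))"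
        by (simp add: q_def poly_sum poly_monom mult_ac)
      also have "\<dots> = 0" using t z by (intro insert.prems(4)) (auto split: if_splits)
      finally show ?thesis .
    qed
    ultimately have "q = 0" using pos by (intro poly_eqI_degree[of "G a"]) auto
    then have "0 = coeff q k" by simp
    also have "\<dots> = (\<Sum>\<gamma>\<in>K k. v \<gamma> * (\<Prod>i\<in>A. z i ^ \<gamma> i))"
      unfolding q_def coeff_sum K_def coeff_monom
      by (subst sum.inter_filter[symmetric, OF insert.prems(1)]) (rule sum.cong, auto)
    finally show ?thesis by simp
  qed
  show ?case
  proof (rule insert.IH[of "K (\<beta> a)"])
    show "finite (K (\<beta> a))" using insert.prems(1) by (simp add: K_def)
    show "\<gamma> = \<gamma>'" if "\<gamma> \<in> K (\<beta> a)" "\<gamma>' \<in> K (\<beta> a)" "\<And>i. i \<in> A \<Longrightarrow> \<gamma> i = \<gamma>' i" for \<gamma> \<gamma>'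
      using that by (intro insert.prems(2)) (auto simp: K_def)
    show "\<gamma> i < card (G i)" if "\<gamma> \<in> K (\<beta> a)" "i \<in> A" for \<gamma> i
      using that insert.prems(3) by (auto simp: K_def)
    show "\<beta> \<in> K (\<beta> a)" using insert.prems(5) by (simp add: K_def)
  qed (use zero in auto)
qed

lemma polys_le_coeffs_eq_0:
  fixes v :: "('n::finite \<Rightarrow> nat) \<Rightarrow> real"
  assumes "\<And>i. m < card (G i)"
    and zero: "\<And>y. (\<And>i. y $ i \<in> G i) \<Longrightarrow> (\<Sum>\<beta>\<in>multi_indices m. v \<beta> * mpow y \<beta>) = 0"
    and "\<beta> \<in> multi_indices m"
  shows "v \<beta> = 0"
proof (rule grid_unisolvent[where A = UNIV and I = "multi_indices m" and G = G])
  show "\<beta> i < card (G i)" if "\<beta> \<in> multi_indices m" for \<beta> i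
    using that assms(1)[of i] member_le_sum[of i UNIV \<beta>] by (simp add: multi_indices_def)
  show "(\<Sum>\<beta>\<in>multi_indices m. v \<beta> * (\<Prod>i\<in>UNIV. z i ^ \<beta> i)) = 0"
    if "\<And>i. i \<in> UNIV \<Longrightarrow> z i \<in> G i" for z
    using zero[of "\<chi> i. z i"] that by (simp add: mpow_def)
qed (use assms finite_multi_indices in auto)

text \<open>Serves both the MLS matrix and, with unit weights, the Gram matrix of the monomials on a
  grid.\<close>

lemma rayleigh_weighted_gram:
  assumes "\<And>i k. i \<in> I \<Longrightarrow> k \<in> I \<Longrightarrow> A i k = (\<Sum>j\<in>J. w j * f j i * f j k)"
  shows "rayleigh I A v = (\<Sum>j\<in>J. w j * (\<Sum>i\<in>I. v i * f j i)\<^sup>2) / (\<Sum>i\<in>I. v i * v i)"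
proof -
  have "(\<Sum>i\<in>I. \<Sum>k\<in>I. v i * A i k * v k)
      = (\<Sum>i\<in>I. \<Sum>k\<in>I. \<Sum>j\<in>J. w j * (v i * f j i) * (v k * f j k))"
    by (intro sum.cong refl) (simp add: assms sum_distrib_left sum_distrib_right mult_ac)
  also have "\<dots> = (\<Sum>i\<in>I. \<Sum>j\<in>J. \<Sum>k\<in>I. w j * (v i * f j i) * (v k * f j k))"
    by (intro sum.cong refl sum.swap)
  also have "\<dots> = (\<Sum>j\<in>J. \<Sum>i\<in>I. \<Sum>k\<in>I. w j * (v i * f j i) * (v k * f j k))"
    by (rule sum.swap)
  also have "\<dots> = (\<Sum>j\<in>J. w j * (\<Sum>i\<in>I. v i * f j i)\<^sup>2)"
    by (simp add: power2_eq_square sum_product sum_distrib_left mult_ac)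
  finally show ?thesis by (simp add: rayleigh_def)
qed

text \<open>A grid with \<open>m + 1\<close> values per coordinate fits into the ball and determines
  the coefficients, so its Gram matrix has a positive smallest eigenvalue. Dividing that by the
  number of grid points gives a \<open>\<kappa>\<close> that depends on neither \<open>v\<close> nor
  \<open>M\<close>.\<close>

lemma polys_le_sup_norm_ge:
  fixes c :: "real^'n::finite"
  assumes "0 < \<rho>"
  shows "\<exists>\<kappa>>0. \<forall>v M. (\<forall>z\<in>cball c \<rho>. \<bar>\<Sum>\<beta>\<in>multi_indices m. v \<beta> * mpow z \<beta>\<bar> \<le> M) \<longrightarrow>
           \<kappa> * (\<Sum>\<beta>\<in>multi_indices m. v \<beta> * v \<beta>) \<le> M\<^sup>2"
proof -
  let ?I = "multi_indices m :: ('n \<Rightarrow> nat) set"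
  \<comment> \<open>The mesh keeps each coordinate within \<open>\<rho> / CARD('n)\<close> of the
    centre, so even the 1-norm distance is at most \<open>\<rho>\<close>.\<close>
  define \<epsilon> where "\<epsilon> = \<rho> / (real CARD('n) * (real m + 1))"
  have e: "\<epsilon> > 0" using assms by (simp add: \<epsilon>_def)
  define G where "G i = (\<lambda>k. c $ i + \<epsilon> * real k) ` {..m}" for i
  have cardG: "card (G i) = m + 1" for i
    unfolding G_def using e by (subst card_image) (auto simp: inj_on_def)
  define Y where "Y = {y :: real^'n. \<forall>i. y $ i \<in> G i}"
  have "Y \<subseteq> vec_lambda ` (\<Pi>\<^sub>E i\<in>UNIV. G i)"
  proof
    fix y assume "y \<in> Y"
    then show "y \<in> vec_lambda ` (\<Pi>\<^sub>E i\<in>UNIV. G i)"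
      by (intro image_eqI[of _ _ "vec_nth y"]) (auto simp: Y_def)
  qed
  then have finY: "finite Y" by (rule finite_subset) (auto intro!: finite_PiE simp: G_def)
  have "vec_lambda (\<lambda>i. c $ i) \<in> Y" by (auto simp: Y_def G_def intro!: image_eqI[of _ _ 0])
  then have Y0: "card Y > 0" using finY by (auto simp: card_gt_0_iff)
  have Yball: "Y \<subseteq> cball c \<rho>"
  proof
    fix y assume y: "y \<in> Y"
    have "\<bar>(y - c) $ i\<bar> \<le> \<rho> / real CARD('n)" for i
    proof -
      obtain k where k: "k \<le> m" "y $ i = c $ i + \<epsilon> * real k" using y by (force simp: Y_def G_def)
      have "\<epsilon> * real k \<le> \<epsilon> * (real m + 1)" using e k by (intro mult_left_mono) auto
      also have "\<dots> = \<rho> / real CARD('n)" by (simp add: \<epsilon>_def add_nonneg_eq_0_iff)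
      finally show ?thesis using e k by (simp add: abs_mult)
    qed
    then have "(\<Sum>i\<in>UNIV. \<bar>(y - c) $ i\<bar>) \<le> (\<Sum>i\<in>(UNIV::'n set). \<rho> / real CARD('n))"
      by (intro sum_mono) auto
    then have "norm (y - c) \<le> \<rho>" using norm_le_l1_cart[of "y - c"] by simp
    then show "y \<in> cball c \<rho>" by (simp add: dist_norm norm_minus_commute)
  qed
  define B where "B \<beta> \<gamma> = (\<Sum>y\<in>Y. 1 * mpow y \<beta> * mpow y \<gamma>)" for \<beta> \<gamma>
  have ray: "rayleigh ?I B v = (\<Sum>y\<in>Y. (\<Sum>\<beta>\<in>?I. v \<beta> * mpow y \<beta>)\<^sup>2) / (\<Sum>\<beta>\<in>?I. v \<beta> * v \<beta>)" for v
    using rayleigh_weighted_gram[of ?I B "\<lambda>_. 1" mpow Y v] by (simp add: B_def)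
  define \<mu> where "\<mu> = lambda_min ?I B"
  have pos: "0 < (\<Sum>\<beta>\<in>?I. v \<beta> * v \<beta>)" if "\<exists>\<beta>\<in>?I. v \<beta> \<noteq> 0" for v :: "('n \<Rightarrow> nat) \<Rightarrow> real"
    using that by (auto intro!: sum_pos2 finite_multi_indices simp: zero_less_mult_iff)
  \<comment> \<open>The minimum is attained at some nonzero \<open>u\<close>; were it zero, the
    polynomial with coefficients \<open>u\<close> would vanish on the whole grid.\<close>
  have "\<mu> > 0"
  proof -
    obtain u where u: "\<exists>\<beta>\<in>?I. u \<beta> \<noteq> 0" "rayleigh ?I B u = \<mu>"
      using lambda_min_is_minimum(1)[OF finite_multi_indices multi_indices_nonempty, of m B]
      unfolding \<mu>_def by blast
    have "\<exists>y\<in>Y. (\<Sum>\<beta>\<in>?I. u \<beta> * mpow y \<beta>) \<noteq> 0"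
      using u(1) polys_le_coeffs_eq_0[of m G u] cardG by (fastforce simp: Y_def)
    then have "0 < (\<Sum>y\<in>Y. (\<Sum>\<beta>\<in>?I. u \<beta> * mpow y \<beta>)\<^sup>2)"
      using finY by (auto intro!: sum_pos2)
    then have "0 < rayleigh ?I B u"
      unfolding ray using pos[OF u(1)] by (rule divide_pos_pos)
    then show ?thesis using u(2) by simp
  qed
  have "\<mu> / card Y * (\<Sum>\<beta>\<in>?I. v \<beta> * v \<beta>) \<le> M\<^sup>2"
    if M: "\<forall>z\<in>cball c \<rho>. \<bar>\<Sum>\<beta>\<in>?I. v \<beta> * mpow z \<beta>\<bar> \<le> M" for v M
  proof (cases "\<exists>\<beta>\<in>?I. v \<beta> \<noteq> 0")
    case True
    have "\<mu> \<le> rayleigh ?I B v"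
      unfolding \<mu>_def by (rule lambda_min_is_minimum(2)[OF finite_multi_indices multi_indices_nonempty True])
    then have "\<mu> * (\<Sum>\<beta>\<in>?I. v \<beta> * v \<beta>) \<le> (\<Sum>y\<in>Y. (\<Sum>\<beta>\<in>?I. v \<beta> * mpow y \<beta>)\<^sup>2)"
      using pos[OF True] by (simp add: ray pos_le_divide_eq)
    also have "\<dots> \<le> (\<Sum>y\<in>Y. M\<^sup>2)"
    proof (rule sum_mono)
      fix y assume "y \<in> Y"
      then have "\<bar>\<Sum>\<beta>\<in>?I. v \<beta> * mpow y \<beta>\<bar> \<le> M" using M Yball by blast
      then show "(\<Sum>\<beta>\<in>?I. v \<beta> * mpow y \<beta>)\<^sup>2 \<le> M\<^sup>2"
        using power_mono[of "\<bar>\<Sum>\<beta>\<in>?I. v \<beta> * mpow y \<beta>\<bar>" M 2] by simp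
    qed
    finally show ?thesis using Y0 by (simp add: field_simps)
  next
    case False
    then have "(\<Sum>\<beta>\<in>?I. v \<beta> * v \<beta>) = 0" by (intro sum.neutral) auto
    then show ?thesis by simp
  qed
  then show ?thesis using \<open>\<mu> > 0\<close> Y0 by (intro exI[of _ "\<mu> / card Y"]) auto
qed

section \<open>Cone geometry and fill distance\<close>

text \<open>The ball around \<open>a *\<^sub>R \<xi>\<close> of radius
  \<open>a * sin \<theta>\<close> touches the cone from inside. Expanding the square bounds
  \<open>2 * a * (y \<bullet> \<xi>)\<close> below by the sum of the squares of
  \<open>norm y\<close> and \<open>a * cos \<theta>\<close>, which is at least twice their
  product.\<close>

lemma ball_in_cone:
  fixes \<xi> y :: "'a::real_inner"
  assumes "norm \<xi> = 1" "0 < a" "0 \<le> cos \<theta>" "norm (y - a *\<^sub>R \<xi>) \<le> a * sin \<theta>"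
  shows "norm y * cos \<theta> \<le> y \<bullet> \<xi>"
proof -
  have "(norm (y - a *\<^sub>R \<xi>))\<^sup>2 \<le> (a * sin \<theta>)\<^sup>2" using assms(4) by (intro power_mono) auto
  moreover have "(norm (y - a *\<^sub>R \<xi>))\<^sup>2 = (norm y)\<^sup>2 - 2 * a * (y \<bullet> \<xi>) + a\<^sup>2"
    unfolding power2_norm_eq_inner using assms(1)
    by (simp add: norm_eq_1 inner_simps inner_commute power2_eq_square)
  moreover have "(a * sin \<theta>)\<^sup>2 = a\<^sup>2 - (a * cos \<theta>)\<^sup>2"
    by (simp add: power_mult_distrib sin_squared_eq algebra_simps)
  moreover have "0 \<le> (norm y - a * cos \<theta>)\<^sup>2" by simp
  ultimately have "2 * a * (norm y * cos \<theta>) \<le> 2 * a * (y \<bullet> \<xi>)"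
    by (simp add: power2_diff algebra_simps)
  then show ?thesis using assms(2) by simp
qed


text \<open>Boundedness of \<open>\<Omega>\<close> makes the distances to \<open>X\<close> bounded
  above, so that the supremum in \<open>fill_distance\<close> really is an upper bound.\<close>

lemma exists_point_within_fill_distance:
  fixes \<Omega> X :: "(real^'n::finite) set"
  assumes "bounded \<Omega>" "finite X" "X \<noteq> {}" "X \<subseteq> \<Omega>" "y \<in> \<Omega>"
  shows "\<exists>z\<in>X. norm (y - z) \<le> fill_distance X \<Omega>"
proof -
  obtain b where b: "\<And>z. z \<in> \<Omega> \<Longrightarrow> norm z \<le> b" using assms(1) by (auto simp: bounded_iff)
  let ?d = "\<lambda>y. Min ((\<lambda>z. norm (y - z)) ` X)"
  have "?d y \<le> 2 * b" if "y \<in> \<Omega>" for y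
  proof -
    obtain z where z: "z \<in> X" using assms(3) by blast
    have "?d y \<le> norm (y - z)" using assms(2) z by (intro Min_le) auto
    also have "\<dots> \<le> norm y + norm z" by (rule norm_triangle_ineq4)
    also have "\<dots> \<le> 2 * b" using b[of y] b[of z] z that assms(4) by auto
    finally show ?thesis .
  qed
  then have "bdd_above (?d ` \<Omega>)" by (intro bdd_aboveI2) auto
  then have "?d y \<le> fill_distance X \<Omega>"
    unfolding fill_distance_def using assms(5) by (intro cSUP_upper)
  moreover have "?d y \<in> (\<lambda>z. norm (y - z)) ` X" using assms(2,3) by (intro Min_in) auto
  ultimately show ?thesis by auto
qed

text \<open>The axis of the cone is a nondegenerate segment in \<open>\<Omega>\<close>. This later
  excludes fill distance zero for a finite set of points.\<close>

lemma interior_cone_condition_infinite: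
  assumes "interior_cone_condition \<Omega> \<theta> r" "0 < r" "x \<in> \<Omega>"
  shows "infinite \<Omega>"
proof -
  obtain \<xi> where \<xi>: "norm \<xi> = 1"
    "{x + t *\<^sub>R y | t y. norm y = 1 \<and> y \<bullet> \<xi> \<ge> cos \<theta> \<and> t \<in> {0..r}} \<subseteq> \<Omega>"
    using assms(1,3) unfolding interior_cone_condition_def by blast
  have "\<xi> \<bullet> \<xi> \<ge> cos \<theta>" using \<xi>(1) by (simp add: norm_eq_1)
  then have "(\<lambda>t. x + t *\<^sub>R \<xi>) ` {0..r} \<subseteq> \<Omega>" using \<xi> by blast
  moreover have "inj_on (\<lambda>t. x + t *\<^sub>R \<xi>) {0..r}" using \<xi>(1) by (auto simp: inj_on_def)
  moreover have "infinite {0..r}" using \<open>0 < r\<close> by (simp add: infinite_Icc)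
  ultimately show ?thesis using finite_imageD finite_subset by blast
qed

section \<open>The eigenvalue bound in scaled coordinates\<close>

theorem lemma3p7:
  fixes m :: nat and \<Omega> :: "(real^'n::finite) set" and r \<theta> C2 h0 :: real
    and \<phi> :: "real \<Rightarrow> real" and xhat :: "real^'n"
  assumes "m \<ge> 1"
    and "bounded \<Omega>"
    and "r > 0" and "0 < \<theta>" and "\<theta> < pi / 2"
    and "interior_cone_condition \<Omega> \<theta> r"
    and "C2 = 16 * (1 + sin \<theta>)\<^sup>2 * (real m)\<^sup>2 / (3 * (sin \<theta>)\<^sup>2)"
    and "h0 = r / C2"
    and "\<forall>t\<in>{0..1/2}. \<phi> t > 0"
    and "\<forall>t>1. \<phi> t = 0"
    and "\<forall>t. \<phi> \<bar>t\<bar> \<ge> 0"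
    and "continuous_on UNIV (\<lambda>t. \<phi> \<bar>t\<bar>)"
    and "xhat \<in> \<Omega>"
  shows "\<exists>C>0. \<forall>(N::nat) (x :: nat \<Rightarrow> real^'n) h \<delta>.
           N \<ge> 1 \<longrightarrow> x ` {1..N} \<subseteq> \<Omega> \<longrightarrow>
           h = fill_distance (x ` {1..N}) \<Omega> \<longrightarrow> h \<le> h0 \<longrightarrow>
           \<delta> = 2 * C2 * h \<longrightarrow>
           unisolvent m (x ` {j\<in>{1..N}. norm (xhat - x j) \<le> \<delta>}) \<longrightarrow>
           lambda_min (multi_indices m)
             (mls_matrix (\<lambda>j y. \<phi> (norm (y - x j) / \<delta>)) N x h xhat) \<ge> C"
proof -
  let ?I = "multi_indices m :: ('n \<Rightarrow> nat) set"
  define s where "s = sin \<theta>"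
  have s: "0 < s" "s \<le> 1" using assms(4,5) by (auto simp: s_def intro: sin_gt_zero)
  have cos: "0 < cos \<theta>" using assms(4,5) by (intro cos_gt_zero) auto
  have C2: "C2 = 16 * (1 + s)\<^sup>2 * (real m)\<^sup>2 / (3 * s\<^sup>2)" using assms(7) by (simp add: s_def)
  then have C2pos: "0 < C2" using s assms(1) by (auto intro!: divide_pos_pos mult_pos_pos)
  \<comment> \<open>The largest ball with centre on the axis that fits in the infinite cone and
    within distance \<open>C2\<close> of the apex: centre at distance \<open>a\<close>, radius
    \<open>a * sin \<theta>\<close>, and \<open>a + \<rho> = C2\<close>.\<close>
  define a where "a = C2 / (1 + s)"
  define \<rho> where "\<rho> = a * s"
  have a: "0 < a" using C2pos s by (simp add: a_def)
  have "a * (1 + s) = C2" using s by (simp add: a_def)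
  then have a\<rho>: "a + \<rho> = C2" by (simp add: \<rho>_def distrib_left)
  have \<rho>: "32 / 3 * (real m)\<^sup>2 \<le> \<rho>"
  proof -
    have "\<rho> = 16 / 3 * (real m)\<^sup>2 * ((1 + s) / s)"
      using s by (simp add: \<rho>_def a_def C2 power2_eq_square)
    moreover have "2 \<le> (1 + s) / s" using s by (simp add: field_simps)
    then have "16 / 3 * (real m)\<^sup>2 * 2 \<le> 16 / 3 * (real m)\<^sup>2 * ((1 + s) / s)"
      by (intro mult_left_mono) auto
    ultimately show ?thesis by simp
  qed
  have "1 \<le> (real m)\<^sup>2" using assms(1) by simp
  then have \<rho>3: "3 \<le> \<rho>" using \<rho> by linarith
  \<comment> \<open>The constant in \<open>C2\<close> was chosen for this: the loss factor on the
    unit ball is at least \<open>7 / 16\<close>.\<close>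
  have "6 * (real m)\<^sup>2 / \<rho> \<le> 9 / 16" using \<rho> \<rho>3 by (simp add: pos_divide_le_eq)
  then have \<rho>m: "7 / 16 \<le> 1 - 6 * (real m)\<^sup>2 / \<rho>" by simp
  obtain \<xi> where \<xi>: "norm \<xi> = 1"
    "{xhat + t *\<^sub>R y | t y. norm y = 1 \<and> y \<bullet> \<xi> \<ge> cos \<theta> \<and> t \<in> {0..r}} \<subseteq> \<Omega>"
    using assms(6,13) unfolding interior_cone_condition_def by blast
  define c where "c = a *\<^sub>R \<xi>"
  have ball_norm: "norm z \<le> C2" if "z \<in> cball c \<rho>" for z
  proof -
    have "norm z \<le> norm c + norm (z - c)" using norm_triangle_ineq[of c "z - c"] by simp
    then show ?thesis using that a a\<rho> \<xi>(1) by (simp add: c_def dist_norm norm_minus_commute)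
  qed
  have ball_\<Omega>: "xhat + h *\<^sub>R y \<in> \<Omega>" if "y \<in> cball c \<rho>" "0 < h" "h \<le> h0" for y h
  proof (cases "y = 0")
    case True
    then show ?thesis using assms(13) by simp
  next
    case False
    have "norm y * cos \<theta> \<le> y \<bullet> \<xi>"
      using that(1) by (intro ball_in_cone[OF \<xi>(1) a] less_imp_le[OF cos])
        (simp add: c_def \<rho>_def s_def dist_norm norm_minus_commute)
    then have "cos \<theta> \<le> (y /\<^sub>R norm y) \<bullet> \<xi>" using False by (simp add: field_simps)
    \<comment> \<open>Scaled points have norm at most \<open>C2\<close>, so
      \<open>h0 = r / C2\<close> keeps them within the cone radius \<open>r\<close>.\<close>
    moreover have "h * norm y \<le> h0 * C2"
      using that ball_norm[OF that(1)] C2pos by (intro mult_mono) auto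
    then have "h * norm y \<in> {0..r}" using that(2) C2pos assms(8) by simp
    moreover have "norm (y /\<^sub>R norm y) = 1" using False by simp
    ultimately have "xhat + (h * norm y) *\<^sub>R (y /\<^sub>R norm y) \<in> \<Omega>" using \<xi>(2) by blast
    then show ?thesis using False by (simp add: mult.assoc)
  qed
  \<comment> \<open>In scaled coordinates the ball does not depend on \<open>h\<close>, so
    \<open>\<kappa>\<close> is fixed before the data points are.\<close>
  obtain \<kappa> where \<kappa>: "0 < \<kappa>"
    "\<And>v M. (\<forall>z\<in>cball c \<rho>. \<bar>\<Sum>\<beta>\<in>?I. v \<beta> * mpow z \<beta>\<bar> \<le> M) \<Longrightarrow> \<kappa> * (\<Sum>\<beta>\<in>?I. v \<beta> * v \<beta>) \<le> M\<^sup>2"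
    using polys_le_sup_norm_ge[of \<rho> c m] \<rho>3 by auto
  obtain w0 where w0: "0 < w0" "\<And>t. 0 \<le> t \<Longrightarrow> t \<le> 1 / 2 \<Longrightarrow> w0 \<le> \<phi> t"
  proof -
    have "continuous_on {0..1/2} (\<lambda>t. \<phi> \<bar>t\<bar>)" using assms(12) by (rule continuous_on_subset) auto
    then obtain t0 where "t0 \<in> {0..1/2}" "\<And>t. t \<in> {0..1/2} \<Longrightarrow> \<phi> \<bar>t0\<bar> \<le> \<phi> \<bar>t\<bar>"
      using continuous_attains_inf[of "{0..1/2::real}"] by force
    then show ?thesis using that[of "\<phi> t0"] assms(9) by force
  qed
  define C where "C = w0 * ((7 / 16)\<^sup>2 * \<kappa>)"
  have Cpos: "0 < C" using w0 \<kappa> by (simp add: C_def)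
  have "C \<le> lambda_min ?I (mls_matrix (\<lambda>j y. \<phi> (norm (y - x j) / \<delta>)) N x h xhat)"
    if N: "N \<ge> 1" and X: "x ` {1..N} \<subseteq> \<Omega>" and h: "h = fill_distance (x ` {1..N}) \<Omega>" "h \<le> h0"
      and \<delta>: "\<delta> = 2 * C2 * h" for N x h \<delta>
  proof -
    have fill: "\<exists>j\<in>{1..N}. norm (y - x j) \<le> h" if "y \<in> \<Omega>" for y
      using exists_point_within_fill_distance[OF assms(2) _ _ X that] N h(1) by auto
    \<comment> \<open>Otherwise every point of \<open>\<Omega>\<close> would be a data point,
      although \<open>\<Omega>\<close> is infinite.\<close>
    have hpos: "0 < h"
    proof (rule ccontr)
      assume "\<not> 0 < h"
      have "\<Omega> \<subseteq> x ` {1..N}"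
      proof
        fix y assume "y \<in> \<Omega>"
        then obtain j where "j \<in> {1..N}" "norm (y - x j) \<le> h" using fill by blast
        moreover from this have "norm (y - x j) \<le> 0" using \<open>\<not> 0 < h\<close> by linarith
        ultimately show "y \<in> x ` {1..N}" by simp
      qed
      then show False
        using interior_cone_condition_infinite[OF assms(6,3,13)] finite_subset by blast
    qed
    define z where "z j = (x j - xhat) /\<^sub>R h" for j
    let ?w = "\<lambda>j. \<phi> (norm (xhat - x j) / \<delta>)"
    let ?A = "mls_matrix (\<lambda>j y. \<phi> (norm (y - x j) / \<delta>)) N x h xhat"
    have ray: "rayleigh ?I ?A v = (\<Sum>j=1..N. ?w j * (\<Sum>\<beta>\<in>?I. v \<beta> * mpow (z j) \<beta>)\<^sup>2) / (\<Sum>\<beta>\<in>?I. v \<beta> * v \<beta>)" for v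
      by (rule rayleigh_weighted_gram) (simp add: mls_matrix_def z_def)
    have w_nonneg: "0 \<le> ?w j" for j
      using assms(11)[rule_format, of "norm (xhat - x j) / \<delta>"] hpos C2pos \<delta> by simp
    \<comment> \<open>A minimiser of the Rayleigh quotient supplies the coefficients of the
      polynomial \<open>p\<close>, so it is enough to bound this single quotient.\<close>
    obtain v where v: "\<exists>\<beta>\<in>?I. v \<beta> \<noteq> 0" "rayleigh ?I ?A v = lambda_min ?I ?A"
      using lambda_min_is_minimum(1)[OF finite_multi_indices multi_indices_nonempty, of m ?A] by blast
    have vpos: "0 < (\<Sum>\<beta>\<in>?I. v \<beta> * v \<beta>)"
      using v(1) by (auto intro!: sum_pos2 finite_multi_indices simp: zero_less_mult_iff)
    define p where "p u = (\<Sum>\<beta>\<in>?I. v \<beta> * mpow u \<beta>)" for u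
    have "p \<in> polys_le m" unfolding polys_le_def p_def by blast
    then obtain y where y: "cball y 1 \<subseteq> cball c \<rho>"
      "\<And>u u'. u \<in> cball y 1 \<Longrightarrow> u' \<in> cball c \<rho> \<Longrightarrow> \<bar>p u'\<bar> * (1 - 6 * (real m)\<^sup>2 / \<rho>) \<le> \<bar>p u\<bar>"
      using polys_le_large_on_unit_ball[of m p \<rho> c] assms(1) \<rho>3 by auto
    have "y \<in> cball y 1" by simp
    then have "y \<in> cball c \<rho>" using y(1) by blast
    \<comment> \<open>The point corresponding to \<open>y\<close> lies in \<open>\<Omega>\<close>,
      so a data point is within \<open>h\<close> of it, that is, within \<open>1\<close> after
      scaling.\<close>
    then obtain j where j: "j \<in> {1..N}" "norm (xhat + h *\<^sub>R y - x j) \<le> h"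
      using fill[OF ball_\<Omega>[OF _ hpos h(2)]] by blast
    have "xhat + h *\<^sub>R y - x j = h *\<^sub>R (y - z j)" using hpos by (simp add: z_def algebra_simps)
    then have zj: "z j \<in> cball y 1" using j(2) hpos by (simp add: dist_norm)
    then have zb: "z j \<in> cball c \<rho>" using y(1) by blast
    have "norm (xhat - x j) = h * norm (z j)" using hpos by (simp add: z_def norm_minus_commute)
    also have "\<dots> \<le> h * C2" using ball_norm[OF zb] hpos by (intro mult_left_mono) auto
    \<comment> \<open>The distance to \<open>xhat\<close> is at most \<open>h * C2\<close>, half of
      \<open>\<delta>\<close>, so the argument of \<open>\<phi>\<close> is at most
      \<open>1/2\<close>.\<close>
    finally have wj: "w0 \<le> ?w j"
      using hpos C2pos by (intro w0(2)) (auto simp: \<delta> field_simps)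
    have "\<bar>p u\<bar> \<le> 16 / 7 * \<bar>p (z j)\<bar>" if "u \<in> cball c \<rho>" for u
      using order.trans[OF mult_left_mono[OF \<rho>m, of "\<bar>p u\<bar>"] y(2)[OF zj that]] by simp
    then have "\<kappa> * (\<Sum>\<beta>\<in>?I. v \<beta> * v \<beta>) \<le> (16 / 7 * \<bar>p (z j)\<bar>)\<^sup>2" by (intro \<kappa>(2)) (simp add: p_def)
    then have "(7 / 16)\<^sup>2 * \<kappa> * (\<Sum>\<beta>\<in>?I. v \<beta> * v \<beta>) \<le> (p (z j))\<^sup>2"
      by (simp add: power_mult_distrib power_divide)
    then have "w0 * ((7 / 16)\<^sup>2 * \<kappa> * (\<Sum>\<beta>\<in>?I. v \<beta> * v \<beta>)) \<le> ?w j * (p (z j))\<^sup>2"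
      using wj w0(1) \<kappa>(1) vpos by (intro mult_mono) auto
    \<comment> \<open>All weights are nonnegative, so the single summand at \<open>j\<close> bounds
      the sum from below.\<close>
    also have "\<dots> \<le> (\<Sum>j=1..N. ?w j * (p (z j))\<^sup>2)"
      using j(1) w_nonneg by (intro member_le_sum[where f = "\<lambda>j. ?w j * (p (z j))\<^sup>2"]) auto
    finally have "C \<le> rayleigh ?I ?A v"
      using vpos by (simp add: ray p_def C_def pos_le_divide_eq mult_ac)
    then show ?thesis using v(2) by simp
  qed
  then show ?thesis using Cpos by blast
qed

end
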